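(* For every integer $\delta \geq 1$ there is an integer $k_\delta$ such that for all integers $k \geq k_\delta$ the following hold. (i) For each $r \in \{0,1,2,\dots,2\delta\}$, there is a $K_{2\delta+1}$-saturated graph with $3\delta k + r$ vertices that is $[(3\delta-2)k + (r-1)]$-regular. (ii) For each $r \in \{1,2,\dots,2\delta+1\}$, there is a $K_{2\delta+2}$-saturated graph with $(3\delta+2)k + r$ vertices that is $[3\delta k + (r-1)]$-regular.
   Context: All graphs are finite and simple. For a graph $F$, a graph $G$ is $F$-saturated if $G$ contains no subgraph isomorphic to $F$, but adding any edge between two nonadjacent vertices of $G$ creates a subgraph isomorphic to $F$. A graph is $d$-regular if every vertex has degree $d$. $K_s$ denotes the complete graph on $s$ vertices. *)

theory Defs
  imports Main
begin

text \<open>A graph is a pair of a vertex set and a set of edges, an edge being the two-element set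
  of its end vertices; hence there are no loops, multiple edges or directions.\<close>

type_synonym 'a ugraph = "'a set \<times> 'a set set"

abbreviation verts :: "'a ugraph \<Rightarrow> 'a set" where
  "verts G \<equiv> fst G"

abbreviation edges :: "'a ugraph \<Rightarrow> 'a set set" where
  "edges G \<equiv> snd G"

definition simple_graph :: "'a ugraph \<Rightarrow> bool" where
  "simple_graph G \<longleftrightarrow> finite (verts G) \<and> (\<forall>e\<in>edges G. e \<subseteq> verts G \<and> card e = 2)"

definition subgraph :: "'a ugraph \<Rightarrow> 'a ugraph \<Rightarrow> bool" where
  "subgraph H G \<longleftrightarrow> simple_graph H \<and> verts H \<subseteq> verts G \<and> edges H \<subseteq> edges G"

definition graph_iso :: "'a ugraph \<Rightarrow> 'b ugraph \<Rightarrow> bool" where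
  "graph_iso F H \<longleftrightarrow> (\<exists>f. bij_betw f (verts F) (verts H) \<and> edges H = (\<lambda>e. f ` e) ` edges F)"

definition contains_copy :: "'a ugraph \<Rightarrow> 'b ugraph \<Rightarrow> bool" where
  "contains_copy G F \<longleftrightarrow> (\<exists>H. subgraph H G \<and> graph_iso F H)"

definition add_edge :: "'a \<Rightarrow> 'a \<Rightarrow> 'a ugraph \<Rightarrow> 'a ugraph" where
  "add_edge u v G = (verts G, insert {u, v} (edges G))"

definition saturated :: "'b ugraph \<Rightarrow> 'a ugraph \<Rightarrow> bool" where
  "saturated F G \<longleftrightarrow> \<not> contains_copy G F \<and>
     (\<forall>u\<in>verts G. \<forall>v\<in>verts G. u \<noteq> v \<and> {u, v} \<notin> edges G \<longrightarrow> contains_copy (add_edge u v G) F)"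

definition degree :: "'a ugraph \<Rightarrow> 'a \<Rightarrow> nat" where
  "degree G v = card {u \<in> verts G. {u, v} \<in> edges G}"

definition regular :: "nat \<Rightarrow> 'a ugraph \<Rightarrow> bool" where
  "regular d G \<longleftrightarrow> (\<forall>v\<in>verts G. degree G v = d)"

definition complete_graph :: "nat \<Rightarrow> nat ugraph" where
  "complete_graph s = ({..<s}, {e. e \<subseteq> {..<s} \<and> card e = 2})"

text \<open>Pitfall: degrees are natural numbers, so a degree such as \<open>a * k + (r - 1)\<close> with
  \<open>r = 0\<close> allowed has to be written \<open>a * k + r - 1\<close>. For \<open>a \<ge> 1\<close> this truncates only if
  \<open>k = r = 0\<close>; a graph on \<open>b * k + r\<close> vertices is then empty and regular of every degree.\<close>

end

theory Submission
  imports Defs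
begin

text \<open>The join of regular graphs in which every vertex has the same number \<open>2k\<close> of
  non-neighbours again has this property, and joining a \<open>K\<^bsub>s+1\<^esub>\<close>-saturated with a
  \<open>K\<^bsub>t+1\<^esub>\<close>-saturated graph gives a \<open>K\<^bsub>s+t+1\<^esub>\<close>-saturated one.
  So it suffices to find \<open>K\<^sub>3\<close>-saturated graphs of this kind on \<open>3k\<close>, \<open>3k + 1\<close> and \<open>3k + 2\<close>
  vertices; together with an independent set of \<open>2k + 1\<close> vertices for odd clique numbers they
  give all cases. The \<open>K\<^sub>3\<close>-saturated graphs are Cayley graphs of \<open>\<int>/n\<close> for symmetric complete
  sum-free sets: the middle third for \<open>n = 3k + 2\<close> (the Andrasfai graph), and perturbations of
  the middle third near its ends for \<open>n = 3k\<close> and \<open>n = 3k + 1\<close>.\<close>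

section \<open>Clique saturation of adjacency relations and its invariance under renaming\<close>

text \<open>Here \<open>c\<close> counts the non-neighbours of a vertex including the vertex itself.\<close>

definition clique_saturated :: "nat \<Rightarrow> nat \<Rightarrow> 'a set \<Rightarrow> ('a \<Rightarrow> 'a \<Rightarrow> bool) \<Rightarrow> bool" where
  "clique_saturated s c V E \<longleftrightarrow> finite V \<and> symp E \<and> irreflp E
     \<and> (\<forall>C. C \<subseteq> V \<and> pairwise E C \<longrightarrow> card C \<le> s)
     \<and> (\<exists>C. C \<subseteq> V \<and> pairwise E C \<and> card C = s)
     \<and> (\<forall>u\<in>V. \<forall>v\<in>V. u \<noteq> v \<and> \<not> E u v \<longrightarrow>
          (\<exists>K. K \<subseteq> V - {u, v} \<and> Suc (card K) = s \<and> pairwise E (insert u K) \<and> pairwise E (insert v K)))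
     \<and> (\<forall>v\<in>V. card {u\<in>V. \<not> E u v} = c)"

lemma clique_saturatedI:
  assumes "finite V" "symp E" "irreflp E"
    and "\<And>C. C \<subseteq> V \<Longrightarrow> pairwise E C \<Longrightarrow> card C \<le> s"
    and "\<exists>C. C \<subseteq> V \<and> pairwise E C \<and> card C = s"
    and "\<And>u v. u \<in> V \<Longrightarrow> v \<in> V \<Longrightarrow> u \<noteq> v \<Longrightarrow> \<not> E u v \<Longrightarrow>
      \<exists>K. K \<subseteq> V - {u, v} \<and> Suc (card K) = s \<and> pairwise E (insert u K) \<and> pairwise E (insert v K)"
    and "\<And>v. v \<in> V \<Longrightarrow> card {u\<in>V. \<not> E u v} = c"
  shows "clique_saturated s c V E"
  using assms unfolding clique_saturated_def by simp

lemma clique_saturated_extend: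
  assumes "clique_saturated s c V E" "u \<in> V" "v \<in> V" "u \<noteq> v" "\<not> E u v"
  obtains K where "K \<subseteq> V - {u, v}" "Suc (card K) = s"
    "pairwise E (insert u K)" "pairwise E (insert v K)"
  using assms unfolding clique_saturated_def by meson

text \<open>Injective renaming preserves cliques, their sizes and non-neighbour counts. This moves
  graphs built on a sum type or on integer residues to an initial segment of the naturals.\<close>

lemma clique_saturated_transport:
  assumes g: "bij_betw g W V" and sat: "clique_saturated s c V E"
  shows "clique_saturated s c W (\<lambda>x y. x \<noteq> y \<and> E (g x) (g y))"
proof -
  let ?F = "\<lambda>x y. x \<noteq> y \<and> E (g x) (g y)"
  have inj: "inj_on g W" and im: "g ` W = V"
    using g by (auto simp: bij_betw_def)
  have irr: "\<not> E x x" for x using sat by (auto simp: clique_saturated_def irreflp_def)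
  have pw: "pairwise ?F C \<longleftrightarrow> pairwise E (g ` C)" if "C \<subseteq> W" for C
    using inj_on_subset[OF inj that] by (auto simp: pairwise_def inj_on_def)
  have lift: "\<exists>D\<subseteq>W. g ` D = C" if "C \<subseteq> V" for C
    using that im by (metis subset_imageE)
  have crd: "card (g ` C) = card C" if "C \<subseteq> W" for C
    using inj_on_subset[OF inj that] by (rule card_image)
  have fin: "finite W" using sat g bij_betw_finite by (auto simp: clique_saturated_def)
  have 1: "card C \<le> s" if "C \<subseteq> W" "pairwise ?F C" for C
    using sat that pw[of C] crd[of C] im unfolding clique_saturated_def
    by (metis (no_types, lifting) image_mono)
  have 2: "\<exists>C. C \<subseteq> W \<and> pairwise ?F C \<and> card C = s"
  proof -
    obtain C where C: "C \<subseteq> V" "pairwise E C" "card C = s"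
      using sat by (auto simp: clique_saturated_def)
    obtain D where D: "D \<subseteq> W" "g ` D = C" using lift[OF C(1)] by blast
    then have "pairwise ?F D \<and> card D = s" using C pw[of D] crd[of D] by simp
    then show ?thesis using D(1) by blast
  qed
  have 3: "\<exists>K. K \<subseteq> W - {u, v} \<and> Suc (card K) = s \<and> pairwise ?F (insert u K) \<and> pairwise ?F (insert v K)"
    if uv: "u \<in> W" "v \<in> W" "u \<noteq> v" "\<not> ?F u v" for u v
  proof -
    have "g u \<in> V" "g v \<in> V" "g u \<noteq> g v" "\<not> E (g u) (g v)"
      using uv inj im by (auto simp: inj_on_def)
    then obtain K where K: "K \<subseteq> V - {g u, g v}" "Suc (card K) = s"
        "pairwise E (insert (g u) K)" "pairwise E (insert (g v) K)"
      by (rule clique_saturated_extend[OF sat])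
    then obtain D where D: "D \<subseteq> W" "g ` D = K" using lift[of K] by blast
    have "D \<subseteq> W - {u, v}" using D K(1) by blast
    moreover have "Suc (card D) = s" using crd[of D] D K(2) by simp
    moreover have "pairwise ?F (insert u D)" "pairwise ?F (insert v D)"
      using pw[of "insert u D"] pw[of "insert v D"] D K uv by auto
    ultimately show ?thesis by blast
  qed
  have 4: "card {u\<in>W. \<not> ?F u v} = c" if v: "v \<in> W" for v
  proof -
    have "g ` {u\<in>W. \<not> ?F u v} = {u\<in>V. \<not> E u (g v)}"
      using im irr by auto
    moreover have "card {u\<in>V. \<not> E u (g v)} = c"
      using sat v im by (auto simp: clique_saturated_def)
    ultimately show ?thesis using crd[of "{u\<in>W. \<not> ?F u v}"] by simp
  qed
  have "symp ?F" "irreflp ?F"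
    using sat by (auto simp: clique_saturated_def symp_def irreflp_def)
  then show ?thesis by (intro clique_saturatedI fin 1 2 3 4)
qed

lemma clique_saturated_nat:
  assumes "clique_saturated s c V E"
  shows "\<exists>F :: nat \<Rightarrow> nat \<Rightarrow> bool. clique_saturated s c {..<card V} F"
proof -
  have "finite V" using assms by (simp add: clique_saturated_def)
  then obtain g where "bij_betw g {..<card V} V"
    using ex_bij_betw_nat_finite[of V] by (auto simp: atLeast0LessThan)
  from clique_saturated_transport[OF this assms] show ?thesis by blast
qed

section \<open>Joins of saturated graphs\<close>

definition join_rel :: "('a \<Rightarrow> 'a \<Rightarrow> bool) \<Rightarrow> ('b \<Rightarrow> 'b \<Rightarrow> bool) \<Rightarrow> 'a + 'b \<Rightarrow> 'a + 'b \<Rightarrow> bool" where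
  "join_rel E F x y = (case (x, y) of (Inl a, Inl b) \<Rightarrow> E a b | (Inr a, Inr b) \<Rightarrow> F a b | _ \<Rightarrow> True)"

lemma join_rel_simps [simp]:
  "join_rel E F (Inl a) (Inl b) = E a b"
  "join_rel E F (Inr c) (Inr d) = F c d"
  "join_rel E F (Inl a) (Inr d)"
  "join_rel E F (Inr c) (Inl b)"
  by (simp_all add: join_rel_def)

lemma pairwise_join_rel:
  "pairwise (join_rel E F) (A <+> B) \<longleftrightarrow> pairwise E A \<and> pairwise F B"
  by (simp add: pairwise_def Plus_def ball_Un)

lemma Plus_vimage: "(Inl -` C) <+> (Inr -` C) = C"
  by (auto simp: Plus_def image_iff) (metis obj_sumE)

text \<open>A clique of the join is a clique of each side put together, so clique numbers add.
  Nonadjacent vertices lie on the same side; their witness \<open>K\<close> there is enlarged by a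
  clique of maximum size from the other side, which is what the existence clause of
  \<open>clique_saturated\<close> provides. All non-neighbours of a vertex lie on its own side, so
  \<open>c\<close> is unchanged, and both sides must share it.\<close>

lemma clique_saturated_join:
  assumes V: "clique_saturated s c V E" and W: "clique_saturated t c W F"
  shows "clique_saturated (s + t) c (V <+> W) (join_rel E F)"
proof -
  let ?J = "join_rel E F"
  have fin: "finite V" "finite W" using V W by (auto simp: clique_saturated_def)
  have crd: "card (A <+> B) = card A + card B" if "A \<subseteq> V" "B \<subseteq> W" for A B
    using that fin by (simp add: card_Plus finite_subset)
  obtain CV where CV: "CV \<subseteq> V" "pairwise E CV" "card CV = s"
    using V by (auto simp: clique_saturated_def)
  obtain CW where CW: "CW \<subseteq> W" "pairwise F CW" "card CW = t"
    using W by (auto simp: clique_saturated_def)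
  have 1: "card C \<le> s + t" if C: "C \<subseteq> V <+> W" "pairwise ?J C" for C
  proof -
    have sub: "Inl -` C \<subseteq> V" "Inr -` C \<subseteq> W" using C by auto
    have "pairwise E (Inl -` C)" "pairwise F (Inr -` C)"
      using C(2) pairwise_join_rel[of E F "Inl -` C" "Inr -` C"] by (simp_all add: Plus_vimage)
    then have "card (Inl -` C) \<le> s" "card (Inr -` C) \<le> t"
      using V W sub by (auto simp: clique_saturated_def)
    then show ?thesis using crd[OF sub] by (simp add: Plus_vimage)
  qed
  have 2: "\<exists>C. C \<subseteq> V <+> W \<and> pairwise ?J C \<and> card C = s + t"
    using CV CW crd[of CV CW] pairwise_join_rel[of E F CV CW]
    by (intro exI[of _ "CV <+> CW"]) auto
  have 3: "\<exists>K. K \<subseteq> (V <+> W) - {u, v} \<and> Suc (card K) = s + t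
      \<and> pairwise ?J (insert u K) \<and> pairwise ?J (insert v K)"
    if uv: "u \<in> V <+> W" "v \<in> V <+> W" "u \<noteq> v" "\<not> ?J u v" for u v
  proof (cases u)
    case (Inl a)
    then obtain b where b: "v = Inl b" using uv by (cases v) auto
    then obtain K where K: "K \<subseteq> V - {a, b}" "Suc (card K) = s"
        "pairwise E (insert a K)" "pairwise E (insert b K)"
      using clique_saturated_extend[OF V, of a b] uv Inl by auto
    have i: "insert (Inl x) (K <+> CW) = insert x K <+> CW" for x by auto
    have "K \<subseteq> V" using K(1) by blast
    then show ?thesis
      using K CW crd[of K CW] Inl b
      by (intro exI[of _ "K <+> CW"]) (auto simp: i pairwise_join_rel)
  next
    case (Inr a)
    then obtain b where b: "v = Inr b" using uv by (cases v) auto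
    then obtain K where K: "K \<subseteq> W - {a, b}" "Suc (card K) = t"
        "pairwise F (insert a K)" "pairwise F (insert b K)"
      using clique_saturated_extend[OF W, of a b] uv Inr by auto
    have i: "insert (Inr x) (CV <+> K) = CV <+> insert x K" for x by auto
    have "K \<subseteq> W" using K(1) by blast
    then show ?thesis
      using K CV crd[of CV K] Inr b
      by (intro exI[of _ "CV <+> K"]) (auto simp: i pairwise_join_rel)
  qed
  have 4: "card {u \<in> V <+> W. \<not> ?J u v} = c" if v: "v \<in> V <+> W" for v
  proof (cases v)
    case (Inl a)
    then have "{u \<in> V <+> W. \<not> ?J u v} = Inl ` {u\<in>V. \<not> E u a}" by auto
    then show ?thesis using V v Inl by (auto simp: clique_saturated_def card_image)
  next
    case (Inr a)
    then have "{u \<in> V <+> W. \<not> ?J u v} = Inr ` {u\<in>W. \<not> F u a}" by auto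
    then show ?thesis using W v Inr by (auto simp: clique_saturated_def card_image)
  qed
  have "symp E" "symp F" "irreflp E" "irreflp F"
    using V W by (auto simp: clique_saturated_def)
  then have "symp ?J" "irreflp ?J"
    by (auto simp: symp_def irreflp_def join_rel_def split: sum.splits)
  then show ?thesis by (intro clique_saturatedI finite_Plus fin 1 2 3 4)
qed

text \<open>Fixing the vertex set \<open>{..<n}\<close> keeps the vertex type constant, so that
  joins can be iterated by induction although each one lives on a sum type.\<close>

definition ex_clique_saturated :: "nat \<Rightarrow> nat \<Rightarrow> nat \<Rightarrow> bool" where
  "ex_clique_saturated s c n \<longleftrightarrow> (\<exists>E :: nat \<Rightarrow> nat \<Rightarrow> bool. clique_saturated s c {..<n} E)"

lemma ex_clique_saturated_add:
  assumes "ex_clique_saturated s c m" "ex_clique_saturated t c n"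
  shows "ex_clique_saturated (s + t) c (m + n)"
proof -
  obtain E F :: "nat \<Rightarrow> nat \<Rightarrow> bool"
    where "clique_saturated s c {..<m} E" "clique_saturated t c {..<n} F"
    using assms by (auto simp: ex_clique_saturated_def)
  from clique_saturated_nat[OF clique_saturated_join[OF this]] show ?thesis
    by (simp add: ex_clique_saturated_def card_Plus)
qed

text \<open>Any added edge is itself a \<open>K_2\<close>, so the witness \<open>K\<close> is empty.
  No vertex has a neighbour, hence the non-neighbour count equals the order.\<close>

lemma ex_clique_saturated_independent:
  assumes "n \<ge> 1"
  shows "ex_clique_saturated 1 n n"
proof -
  have "card C \<le> 1" if "pairwise (\<lambda>_ _. False) C" for C :: "nat set"
    using that by (cases "finite C") (auto simp: pairwise_def card_le_Suc0_iff_eq)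
  moreover have "\<exists>C. C \<subseteq> {..<n} \<and> pairwise (\<lambda>_ _. False) C \<and> card C = 1"
    using assms by (intro exI[of _ "{0}"]) auto
  moreover have "\<exists>K. K \<subseteq> {..<n} - {u, v} \<and> Suc (card K) = 1
      \<and> pairwise (\<lambda>_ _. False) (insert u K) \<and> pairwise (\<lambda>_ _. False) (insert v K)" for u v
    by (intro exI[of _ "{}"]) auto
  ultimately have "clique_saturated 1 n {..<n} (\<lambda>_ _. False)"
    unfolding clique_saturated_def by (auto simp: symp_def irreflp_def)
  then show ?thesis by (auto simp: ex_clique_saturated_def)
qed

section \<open>Cayley graphs of the integers modulo \<open>n\<close>\<close>

text \<open>Triangles correspond to solutions of \<open>x + y = z\<close> in \<open>S\<close> modulo
  \<open>n\<close>, and common neighbours of \<open>u\<close> and \<open>v\<close> to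
  representations of \<open>u - v\<close> as a sum of two elements of \<open>S\<close>. Sum-freeness
  has to be checked only over the integers, because the symmetry \<open>neg\<close> turns a sum that
  wraps around into one that does not.\<close>

lemma clique_saturated_circulant:
  fixes n :: int and S :: "int set"
  assumes range: "S \<subseteq> {0<..<n}" and ne: "S \<noteq> {}"
    and neg: "\<And>x. x \<in> S \<Longrightarrow> n - x \<in> S"
    and sum_free: "\<And>x y. x \<in> S \<Longrightarrow> y \<in> S \<Longrightarrow> x + y \<notin> S"
    and complete: "\<And>d. d \<in> {0<..<n} - S \<Longrightarrow> \<exists>x\<in>S. \<exists>y\<in>S. x + y = d \<or> x + y = d + n"
  shows "clique_saturated 2 (nat n - card S) {0..<n} (\<lambda>x y. (x - y) mod n \<in> S)"
proof -
  let ?E = "\<lambda>x y. (x - y) mod n \<in> S"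
  have n: "n > 0" using range ne by fastforce
  have mod_S: "x mod n = x" if "x \<in> S" for x using that range by auto
  have mod_sum: "(x + y) mod n \<notin> S" if "x \<in> S" "y \<in> S" for x y
  proof
    assume z: "(x + y) mod n \<in> S"
    have xy: "0 < x" "x < n" "0 < y" "y < n" using that range by auto
    show False
    proof (cases "x + y < n")
      case True
      then show False using z xy sum_free[OF that] by simp
    next
      case False
      then have "(x + y) mod n = x + y - n"
        using xy by (subst minus_mod_self2[symmetric], subst mod_pos_pos_trivial) auto
      \<comment> \<open>If \<open>z = x + y - n\<close> is in \<open>S\<close>, then
        \<open>z + (n - x) = y\<close> is a forbidden sum that does not wrap.\<close>
      then show False using z sum_free[OF z neg[OF that(1)]] that by simp
    qed
  qed
  have E_sym: "?E y x" if "?E x y" for x y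
  proof -
    have "(x - y) mod n \<noteq> 0" using that range by auto
    then have "(y - x) mod n = n - (x - y) mod n"
      using zmod_zminus1_eq_if[of "x - y" n] by simp
    then show ?thesis using neg[OF that] by simp
  qed
  have irr: "\<not> ?E x x" for x using range by auto
  have triangle_free: False if "?E x y" "?E y z" "?E x z" for x y z
  proof -
    have "((x - y) mod n + (y - z) mod n) mod n = (x - z) mod n"
      by (simp add: mod_add_eq)
    then show False using mod_sum[OF that(1,2)] that(3) by simp
  qed
  have 1: "card C \<le> 2" if "C \<subseteq> {0..<n}" "pairwise ?E C" for C
  proof (rule ccontr)
    assume "\<not> card C \<le> 2"
    then obtain D where "D \<subseteq> C" "card D = 3"
      using obtain_subset_with_card_n[of 3 C] by auto
    then obtain x y z where "{x, y, z} \<subseteq> C" "x \<noteq> y" "y \<noteq> z" "x \<noteq> z"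
      by (auto simp: card_3_iff)
    then show False using that(2) triangle_free[of x y z] by (auto simp: pairwise_def)
  qed
  have 2: "\<exists>C. C \<subseteq> {0..<n} \<and> pairwise ?E C \<and> card C = 2"
  proof -
    obtain x where x: "x \<in> S" using ne by auto
    then have "0 < x" "x < n" using range by auto
    moreover have "?E x 0" using x mod_S by simp
    ultimately show ?thesis using E_sym[of x 0]
      by (intro exI[of _ "{0, x}"]) (auto simp: pairwise_def)
  qed
  have 3: "\<exists>K. K \<subseteq> {0..<n} - {u, v} \<and> Suc (card K) = 2 \<and> pairwise ?E (insert u K) \<and> pairwise ?E (insert v K)"
    if uv: "u \<in> {0..<n}" "v \<in> {0..<n}" "u \<noteq> v" "\<not> ?E u v" for u v
  proof -
    have "(u - v) mod n \<noteq> 0"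
      using uv by (auto simp: mod_eq_0_iff_dvd dest: zdvd_imp_le) (metis mod_eq_dvd_iff mod_pos_pos_trivial)
    then have "(u - v) mod n \<in> {0<..<n} - S"
      using uv(4) pos_mod_sign[OF n, of "u - v"] pos_mod_bound[OF n, of "u - v"] by auto
    then obtain x y where xy: "x \<in> S" "y \<in> S" "x + y = (u - v) mod n \<or> x + y = (u - v) mod n + n"
      using complete by blast
    then have sum: "(x + y) mod n = (u - v) mod n" by auto
    \<comment> \<open>The common neighbour: modulo \<open>n\<close> it differs from \<open>v\<close>
      by \<open>y\<close>, and \<open>u\<close> differs from it by \<open>x\<close>, since
      \<open>x + y\<close> is congruent to \<open>u - v\<close>.\<close>
    let ?w = "(v + y) mod n"
    have wv: "?E ?w v" using xy mod_S[of y] by (simp add: mod_diff_left_eq)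
    have "(u - ?w) mod n = (u - v - y) mod n" by (simp add: mod_diff_right_eq algebra_simps)
    also have "\<dots> = ((x + y) - y) mod n" using sum by (metis mod_diff_left_eq)
    finally have uw: "?E u ?w" using xy mod_S[of x] by simp
    have "?w \<noteq> u" "?w \<noteq> v" using uw wv irr by metis+
    then show ?thesis using n uw wv E_sym
      by (intro exI[of _ "{?w}"]) (auto simp: pairwise_def)
  qed
  have 4: "card {u\<in>{0..<n}. \<not> ?E u v} = nat n - card S" if v: "v \<in> {0..<n}" for v
  proof -
    \<comment> \<open>Translation by \<open>-v\<close> carries the non-neighbours of
      \<open>v\<close> to the residues outside \<open>S\<close>; \<open>v\<close> itself goes to
      0.\<close>
    have "bij_betw (\<lambda>u. (u - v) mod n) {u\<in>{0..<n}. \<not> ?E u v} ({0..<n} - S)"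
    proof (rule bij_betw_byWitness[where f' = "\<lambda>d. (d + v) mod n"])
      show "\<forall>a\<in>{u\<in>{0..<n}. \<not> ?E u v}. ((a - v) mod n + v) mod n = a"
        by (auto simp: mod_add_left_eq)
      show "\<forall>d\<in>{0..<n} - S. ((d + v) mod n - v) mod n = d"
        by (auto simp: mod_diff_left_eq)
      show "(\<lambda>u. (u - v) mod n) ` {u\<in>{0..<n}. \<not> ?E u v} \<subseteq> {0..<n} - S"
        using n by auto
      show "(\<lambda>d. (d + v) mod n) ` ({0..<n} - S) \<subseteq> {u\<in>{0..<n}. \<not> ?E u v}"
        using n by (auto simp: mod_diff_left_eq)
    qed
    then have "card {u\<in>{0..<n}. \<not> ?E u v} = card ({0..<n} - S)" by (rule bij_betw_same_card)
    also have "\<dots> = nat n - card S"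
      using range by (subst card_Diff_subset) (auto intro: finite_subset[of S "{0<..<n}"])
    finally show ?thesis .
  qed
  have "symp ?E" "irreflp ?E" using E_sym irr by (auto simp: symp_def irreflp_def)
  then show ?thesis by (intro clique_saturatedI finite_atLeastLessThan_int 1 2 3 4)
qed

lemma ex_clique_saturated_circulant:
  fixes S :: "int set"
  assumes "S \<subseteq> {0<..<int n}" "S \<noteq> {}"
    and "\<And>x. x \<in> S \<Longrightarrow> int n - x \<in> S"
    and "\<And>x y. x \<in> S \<Longrightarrow> y \<in> S \<Longrightarrow> x + y \<notin> S"
    and "\<And>d. d \<in> {0<..<int n} - S \<Longrightarrow> \<exists>x\<in>S. \<exists>y\<in>S. x + y = d \<or> x + y = d + int n"
  shows "ex_clique_saturated 2 (n - card S) n"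
  using clique_saturated_nat[OF clique_saturated_circulant[OF assms]]
  by (simp add: ex_clique_saturated_def)

section \<open>Three families of complete sum-free sets\<close>

text \<open>Two elements of \<open>S\<close> sum to at least \<open>2 * k + 2\<close>, just past its
  top, so \<open>S\<close> is sum-free; its \<open>k + 1\<close> elements leave
  \<open>2 * k + 1\<close> non-neighbours.\<close>

lemma ex_triangle_saturated_2:
  "ex_clique_saturated 2 (2 * k + 1) (3 * k + 2)"
proof -
  define S where "S = {int k + 1..2 * int k + 1}"
  have card: "card S = k + 1" by (simp add: S_def)
  have "ex_clique_saturated 2 (3 * k + 2 - card S) (3 * k + 2)"
  proof (rule ex_clique_saturated_circulant)
    fix d assume d: "d \<in> {0<..<int (3 * k + 2)} - S"
    show "\<exists>x\<in>S. \<exists>y\<in>S. x + y = d \<or> x + y = d + int (3 * k + 2)"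
    \<comment> \<open>Residues below \<open>S\<close> are sums of two elements reduced by
      \<open>n\<close>; those above \<open>S\<close> are sums without reduction.\<close>
    proof (cases "d \<le> int k")
      case True
      then show ?thesis using d
        by (intro bexI[of _ "2 * int k + 1"] bexI[of _ "d + int k + 1"]) (auto simp: S_def)
    next
      case False
      then show ?thesis using d
        by (intro bexI[of _ "int k + 1"] bexI[of _ "d - int k - 1"]) (auto simp: S_def)
    qed
  qed (auto simp: S_def)
  then show ?thesis by (simp add: card)
qed

text \<open>The symmetric interval \<open>{m + 1..2 * m}\<close> is sum-free of the right size, but
  modulo \<open>3 * m + 1\<close> no two of its elements sum to \<open>m\<close> or
  \<open>2 * m + 1\<close>. Therefore its ends \<open>m + 1\<close> and \<open>2 * m\<close> are
  exchanged for these two residues.\<close>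

lemma ex_triangle_saturated_1:
  assumes "k \<ge> 6"
  shows "ex_clique_saturated 2 (2 * k + 1) (3 * k + 1)"
proof -
  define m where "m = int k"
  define S where "S = {m, 2 * m + 1} \<union> {m + 2..2 * m - 1}"
  have m: "m \<ge> 6" using assms by (simp add: m_def)
  have S_iff: "x \<in> S \<longleftrightarrow> x = m \<or> x = 2 * m + 1 \<or> m + 2 \<le> x \<and> x \<le> 2 * m - 1" for x
    by (auto simp: S_def)
  have n: "int (3 * k + 1) = 3 * m + 1" by (simp add: m_def)
  have card: "card S = k"
    unfolding S_def using assms by (subst card_Un_disjoint) (auto simp: m_def)
  have "ex_clique_saturated 2 (3 * k + 1 - card S) (3 * k + 1)"
  proof (rule ex_clique_saturated_circulant, unfold n)
    fix d assume d: "d \<in> {0<..<3 * m + 1} - S"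
    have sum: "\<exists>x\<in>S. \<exists>y\<in>S. x + y = d \<or> x + y = d + (3 * m + 1)"
      if "\<exists>x\<in>S. d - x \<in> S \<or> d + (3 * m + 1) - x \<in> S"
      using that by (metis add_diff_cancel_left' diff_add_cancel add.commute)
    \<comment> \<open>Sums with \<open>2 * m + 1\<close> or with \<open>m\<close> reach every
      residue outside \<open>S\<close> except 1 and \<open>3 * m\<close>, which would need the
      removed \<open>m + 1\<close> and \<open>2 * m\<close>. Those two are sums of inner
      elements.\<close>
    consider "d = 1" | "2 \<le> d" "d \<le> m - 1" | "d = m + 1" | "d = 2 * m"
      | "2 * m + 2 \<le> d" "d \<le> 3 * m - 1" | "d = 3 * m"
      using d by (fastforce simp: S_iff)
    then show "\<exists>x\<in>S. \<exists>y\<in>S. x + y = d \<or> x + y = d + (3 * m + 1)"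
    proof (cases, goal_cases)
      case 1 show ?case using 1 m by (intro sum bexI[of _ "m + 3"]) (auto simp: S_iff)
    next
      case 2 show ?case using 2 m by (intro sum bexI[of _ "2 * m + 1"]) (auto simp: S_iff)
    next
      case 3 show ?case using 3 m by (intro sum bexI[of _ "2 * m + 1"]) (auto simp: S_iff)
    next
      case 4 show ?case using 4 m by (intro sum bexI[of _ "m"]) (auto simp: S_iff)
    next
      case 5 show ?case using 5 m by (intro sum bexI[of _ "m"]) (auto simp: S_iff)
    next
      case 6 show ?case using 6 m by (intro sum bexI[of _ "m + 2"]) (auto simp: S_iff)
    qed
  \<comment> \<open>Sum-freeness holds because the least sum \<open>m + m\<close> falls into the gap
    at \<open>2 * m\<close>, and every other sum is at least \<open>2 * m + 2\<close>, past the top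
    of \<open>S\<close>.\<close>
  qed (use m in \<open>auto simp: S_iff\<close>)
  then show ?thesis by (simp add: card)
qed

text \<open>The interval \<open>{m + 1..2 * m - 1}\<close> has the right size, but its sums modulo
  \<open>3 * m\<close> miss \<open>m - 1\<close>, \<open>m\<close>, \<open>2 * m\<close> and
  \<open>2 * m + 1\<close>. Inserting \<open>m - 1\<close> and \<open>2 * m + 1\<close> forces out
  \<open>2 * m - 2 = (m - 1) + (m - 1)\<close> and, by symmetry, \<open>m + 2\<close>, which
  restores the size.\<close>

lemma ex_triangle_saturated_0:
  assumes "k \<ge> 9"
  shows "ex_clique_saturated 2 (2 * k + 1) (3 * k)"
proof -
  define m where "m = int k"
  define S where "S = {m - 1, m + 1, 2 * m - 1, 2 * m + 1} \<union> {m + 3..2 * m - 3}"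
  have m: "m \<ge> 9" using assms by (simp add: m_def)
  have S_iff: "x \<in> S \<longleftrightarrow> x = m - 1 \<or> x = m + 1 \<or> x = 2 * m - 1 \<or> x = 2 * m + 1
      \<or> m + 3 \<le> x \<and> x \<le> 2 * m - 3" for x
    by (auto simp: S_def)
  have n: "int (3 * k) = 3 * m" by (simp add: m_def)
  have card: "card S = k - 1"
    unfolding S_def using assms by (subst card_Un_disjoint) (auto simp: m_def)
  have "ex_clique_saturated 2 (3 * k - card S) (3 * k)"
  proof (rule ex_clique_saturated_circulant, unfold n)
    fix x y assume "x \<in> S" "y \<in> S"
    \<comment> \<open>Near its lower end \<open>S\<close> advances in steps of two, so the small
      sums are exactly \<open>2 * m - 2\<close> and \<open>2 * m\<close>, the gaps near its upper
      end; all others exceed \<open>2 * m + 1\<close>.\<close>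
    then have "x = m - 1 \<or> x = m + 1 \<or> m + 3 \<le> x" "y = m - 1 \<or> y = m + 1 \<or> m + 3 \<le> y"
      using m by (auto simp: S_iff)
    then have "x + y = 2 * m - 2 \<or> x + y = 2 * m \<or> 2 * m + 2 \<le> x + y" by linarith
    then show "x + y \<notin> S" using m by (auto simp: S_iff)
  next
    fix d assume d: "d \<in> {0<..<3 * m} - S"
    have low: "\<exists>x\<in>S. \<exists>y\<in>S. x + y = d \<or> x + y = d + 3 * m" if "x \<in> S" "d - x \<in> S" for x
      using that by (intro bexI[of _ x] bexI[of _ "d - x"]) auto
    have high: "\<exists>x\<in>S. \<exists>y\<in>S. x + y = d \<or> x + y = d + 3 * m" if "x \<in> S" "d + 3 * m - x \<in> S" for x
      using that by (intro bexI[of _ x] bexI[of _ "d + 3 * m - x"]) auto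
    \<comment> \<open>Sums with \<open>2 * m + 1\<close> or with \<open>m - 1\<close> give the two
      middle cases. The residues 1, 3 and their negatives would need elements in the gaps of
      \<open>S\<close>, so they are written as sums of inner elements; for 3 the second summand is
      \<open>m + 6\<close>, and \<open>m \<ge> 9\<close> ensures that it is at most
      \<open>2 * m - 3\<close>.\<close>
    consider "d = 1 \<or> d = 3" | "d = 2 \<or> 4 \<le> d \<and> d \<le> m - 2 \<or> d = m \<or> d = m + 2"
      | "d = 2 * m - 2 \<or> d = 2 * m \<or> 2 * m + 2 \<le> d \<and> d \<le> 3 * m - 4 \<or> d = 3 * m - 2"
      | "d = 3 * m - 3 \<or> d = 3 * m - 1"
      using d unfolding Diff_iff S_iff greaterThanLessThan_iff by atomize_elim presburger
    then show "\<exists>x\<in>S. \<exists>y\<in>S. x + y = d \<or> x + y = d + 3 * m"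
    proof (cases, goal_cases)
      case 1 show ?case by (rule high[of "2 * m - 3"]) (use 1 m in \<open>auto simp: S_iff\<close>)
    next
      case 2 show ?case by (rule high[of "2 * m + 1"]) (use 2 m in \<open>auto simp: S_iff\<close>)
    next
      case 3 show ?case by (rule low[of "m - 1"]) (use 3 m in \<open>auto simp: S_iff\<close>)
    next
      case 4 show ?case by (rule low[of "m + 3"]) (use 4 m in \<open>auto simp: S_iff\<close>)
    qed
  qed (use m in \<open>auto simp: S_iff\<close>)
  then show ?thesis using assms by (simp add: card)
qed

lemma ex_triangle_saturated:
  assumes "k \<ge> 9" "i \<le> 2"
  shows "ex_clique_saturated 2 (2 * k + 1) (3 * k + i)"
proof -
  have "i = 0 \<or> i = 1 \<or> i = 2" using assms(2) by auto
  then show ?thesis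
    using assms(1) ex_triangle_saturated_0[of k] ex_triangle_saturated_1[of k]
      ex_triangle_saturated_2[of k] by auto
qed

section \<open>Iterated joins of triangle-saturated graphs\<close>

lemma ex_clique_saturated_even:
  assumes "k \<ge> 9" "\<delta> \<ge> 1" "r \<le> 2 * \<delta>"
  shows "ex_clique_saturated (2 * \<delta>) (2 * k + 1) (3 * \<delta> * k + r)"
  using assms(2,3)
proof (induction \<delta> arbitrary: r rule: dec_induct)
  case base
  then show ?case using ex_triangle_saturated[OF assms(1), of r] by simp
next
  case (step \<delta>)
  \<comment> \<open>The new factor absorbs up to two units of the excess \<open>r\<close>, leaving
    at most \<open>2 * \<delta>\<close> for the other \<open>\<delta>\<close> factors.\<close>
  have "ex_clique_saturated (2 * \<delta>) (2 * k + 1) (3 * \<delta> * k + (r - min r 2))"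
    by (rule step.IH) (use step.prems in auto)
  moreover have "ex_clique_saturated 2 (2 * k + 1) (3 * k + min r 2)"
    by (rule ex_triangle_saturated[OF assms(1)]) simp
  ultimately have sat: "ex_clique_saturated (2 * \<delta> + 2) (2 * k + 1)
      (3 * \<delta> * k + (r - min r 2) + (3 * k + min r 2))"
    by (rule ex_clique_saturated_add)
  have "2 * \<delta> + 2 = 2 * Suc \<delta>"
      "3 * \<delta> * k + (r - min r 2) + (3 * k + min r 2) = 3 * Suc \<delta> * k + r"
    by (simp_all add: algebra_simps)
  with sat show ?case by (simp only:)
qed

section \<open>From adjacency relations to graphs given by edge sets\<close>

lemma contains_copy_complete_graph:
  assumes "finite (verts G)"
  shows "contains_copy G (complete_graph s) \<longleftrightarrow>
    (\<exists>C\<subseteq>verts G. card C = s \<and> pairwise (\<lambda>x y. {x, y} \<in> edges G) C)"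
proof
  assume "contains_copy G (complete_graph s)"
  then obtain H f where H: "verts H \<subseteq> verts G" "edges H \<subseteq> edges G"
    and f: "bij_betw f {..<s} (verts H)"
    and eH: "edges H = (\<lambda>e. f ` e) ` {e. e \<subseteq> {..<s} \<and> card e = 2}"
    by (auto simp: contains_copy_def subgraph_def graph_iso_def complete_graph_def)
  have "{x, y} \<in> edges G" if xy: "x \<in> verts H" "y \<in> verts H" "x \<noteq> y" for x y
  proof -
    have "x \<in> f ` {..<s}" "y \<in> f ` {..<s}" using f xy by (simp_all add: bij_betw_def)
    then obtain i j where ij: "i < s" "j < s" "x = f i" "y = f j" by auto
    then have "{x, y} = f ` {i, j}" "{i, j} \<subseteq> {..<s}" "card {i, j} = 2"
      using xy by (auto simp: card_2_iff)
    then show ?thesis using eH H by blast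
  qed
  moreover have "card (verts H) = s" using bij_betw_same_card[OF f] by simp
  ultimately show "\<exists>C\<subseteq>verts G. card C = s \<and> pairwise (\<lambda>x y. {x, y} \<in> edges G) C"
    using H by (intro exI[of _ "verts H"]) (auto simp: pairwise_def)
next
  assume "\<exists>C\<subseteq>verts G. card C = s \<and> pairwise (\<lambda>x y. {x, y} \<in> edges G) C"
  then obtain C where C: "C \<subseteq> verts G" "card C = s" "pairwise (\<lambda>x y. {x, y} \<in> edges G) C"
    by blast
  have fin: "finite C" using C assms finite_subset by blast
  obtain f where f: "bij_betw f {..<s} C"
    using ex_bij_betw_nat_finite[OF fin] C by (auto simp: atLeast0LessThan)
  let ?H = "(C, {e. e \<subseteq> C \<and> card e = 2})"
  have inj: "inj_on f {..<s}" and im: "f ` {..<s} = C" using f by (auto simp: bij_betw_def)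
  have "e \<in> edges G" if "e \<subseteq> C" "card e = 2" for e
    using that C(3) by (auto simp: card_2_iff pairwise_def)
  then have "subgraph ?H G"
    using C fin by (auto simp: subgraph_def simple_graph_def)
  moreover have "{e. e \<subseteq> C \<and> card e = 2} = (\<lambda>e. f ` e) ` {e. e \<subseteq> {..<s} \<and> card e = 2}"
  proof (intro subset_antisym subsetI)
    fix e assume "e \<in> {e. e \<subseteq> C \<and> card e = 2}"
    moreover from this obtain d where "d \<subseteq> {..<s}" "e = f ` d"
      using im by (auto elim: subset_imageE)
    ultimately show "e \<in> (\<lambda>e. f ` e) ` {e. e \<subseteq> {..<s} \<and> card e = 2}"
      using card_image[OF inj_on_subset[OF inj]] by auto
  next
    fix e assume "e \<in> (\<lambda>e. f ` e) ` {e. e \<subseteq> {..<s} \<and> card e = 2}"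
    then show "e \<in> {e. e \<subseteq> C \<and> card e = 2}"
      using card_image[OF inj_on_subset[OF inj]] im by auto
  qed
  ultimately show "contains_copy G (complete_graph s)"
    using f unfolding contains_copy_def graph_iso_def complete_graph_def fst_conv snd_conv
    by (intro exI[of _ ?H] conjI exI[of _ f]) (simp_all only: fst_conv snd_conv)
qed

text \<open>The clique bound \<open>s\<close> excludes \<open>K_(s+1)\<close>, and a witness
  \<open>K\<close> together with both ends of an added edge forms one. Since \<open>c\<close> counts
  the vertex itself, the degree is exactly \<open>n - c\<close>.\<close>

lemma ex_saturated_regular_graph:
  assumes "ex_clique_saturated s c n"
  shows "\<exists>G :: nat ugraph. simple_graph G \<and> saturated (complete_graph (s + 1)) G
    \<and> card (verts G) = n \<and> regular (n - c) G"
proof -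
  obtain E :: "nat \<Rightarrow> nat \<Rightarrow> bool" where E: "clique_saturated s c {..<n} E"
    using assms by (auto simp: ex_clique_saturated_def)
  define G :: "nat ugraph" where "G = ({..<n}, {{u, v} | u v. u < n \<and> v < n \<and> E u v})"
  have sym: "E x y \<longleftrightarrow> E y x" and irr: "\<not> E x x" for x y
    using E by (auto simp: clique_saturated_def symp_def irreflp_def)
  have verts: "verts G = {..<n}" by (simp add: G_def)
  have adj: "{x, y} \<in> edges G \<longleftrightarrow> x < n \<and> y < n \<and> E x y" for x y
    using sym by (auto simp: G_def doubleton_eq_iff)
  have simple: "simple_graph G"
    using irr by (auto simp: simple_graph_def G_def card_2_iff) metis
  have pw: "pairwise (\<lambda>x y. {x, y} \<in> edges G) C \<longleftrightarrow> pairwise E C" if "C \<subseteq> {..<n}" for C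
    using that by (auto simp: pairwise_def adj)
  have "\<not> contains_copy G (complete_graph (s + 1))"
  proof
    assume "contains_copy G (complete_graph (s + 1))"
    then obtain C where C: "C \<subseteq> {..<n}" "card C = s + 1" "pairwise E C"
      using contains_copy_complete_graph[of G] pw verts by auto
    have "card C \<le> s" using E C(1,3) by (simp add: clique_saturated_def)
    then show False using C by simp
  qed
  moreover have "contains_copy (add_edge u v G) (complete_graph (s + 1))"
    if uv: "u \<in> verts G" "v \<in> verts G" "u \<noteq> v" "{u, v} \<notin> edges G" for u v
  proof -
    have "\<not> E u v" using uv verts adj by simp
    then obtain K where K: "K \<subseteq> {..<n} - {u, v}" "Suc (card K) = s"
        "pairwise E (insert u K)" "pairwise E (insert v K)"
      using clique_saturated_extend[OF E, of u v] uv verts by auto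
    have "finite K" using K(1) finite_subset by blast
    then have "card (insert u (insert v K)) = s + 1" using K uv by (simp add: subset_Diff_insert)
    \<comment> \<open>Every pair other than \<open>{u, v}\<close> lies in one of the two cliques
      \<open>insert u K\<close> and \<open>insert v K\<close>; the pair \<open>{u, v}\<close> is the
      added edge.\<close>
    moreover have "pairwise (\<lambda>x y. {x, y} \<in> edges (add_edge u v G)) (insert u (insert v K))"
      using K uv verts by (auto simp: pairwise_insert add_edge_def insert_commute adj pairwise_def subset_iff)
    moreover have "insert u (insert v K) \<subseteq> verts (add_edge u v G)"
      using K uv verts by (auto simp: add_edge_def)
    moreover have "finite (verts (add_edge u v G))" using verts by (simp add: add_edge_def)
    ultimately show ?thesis using contains_copy_complete_graph by blast
  qed
  moreover have "degree G v = n - c" if "v \<in> verts G" for v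
  proof -
    have v: "v < n" using that verts by simp
    have "{u \<in> verts G. {u, v} \<in> edges G} = {..<n} - {u \<in> {..<n}. \<not> E u v}"
      using v verts adj by auto
    then have "degree G v = n - card {u \<in> {..<n}. \<not> E u v}"
      unfolding degree_def by (simp only:) (subst card_Diff_subset; auto)
    then show ?thesis using E v by (simp add: clique_saturated_def)
  qed
  ultimately show ?thesis using simple verts
    by (intro exI[of _ G]) (auto simp: saturated_def regular_def)
qed

theorem theorem1p2:
  fixes \<delta> :: nat
  assumes "\<delta> \<ge> 1"
  shows "\<exists>k\<^sub>\<delta>::nat. \<forall>k\<ge>k\<^sub>\<delta>.
    (\<forall>r\<in>{0..2 * \<delta>}. \<exists>G :: nat ugraph. simple_graph G
        \<and> saturated (complete_graph (2 * \<delta> + 1)) G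
        \<and> card (verts G) = 3 * \<delta> * k + r
        \<and> regular ((3 * \<delta> - 2) * k + r - 1) G) \<and>
    (\<forall>r\<in>{1..2 * \<delta> + 1}. \<exists>G :: nat ugraph. simple_graph G
        \<and> saturated (complete_graph (2 * \<delta> + 2)) G
        \<and> card (verts G) = (3 * \<delta> + 2) * k + r
        \<and> regular (3 * \<delta> * k + (r - 1)) G)"
\<comment> \<open>The bound 9 is the largest one among the three triangle-saturated families, and
  joining does not raise it, so it serves every \<open>\<delta>\<close>.\<close>
proof (intro exI[of _ 9] allI impI conjI ballI)
  fix k r :: nat assume k: "k \<ge> 9" and r: "r \<in> {0..2 * \<delta>}"
  \<comment> \<open>The degree is the order minus the \<open>2 * k + 1\<close> non-neighbours;
    \<open>\<delta> \<ge> 1\<close> keeps \<open>3 * \<delta> - 2\<close> from truncating.\<close>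
  have "(3 * \<delta> - 2) * k + r - 1 = 3 * \<delta> * k + r - (2 * k + 1)"
    using assms by (simp add: diff_mult_distrib)
  then show "\<exists>G :: nat ugraph. simple_graph G
        \<and> saturated (complete_graph (2 * \<delta> + 1)) G
        \<and> card (verts G) = 3 * \<delta> * k + r
        \<and> regular ((3 * \<delta> - 2) * k + r - 1) G"
    using ex_saturated_regular_graph[OF ex_clique_saturated_even[OF k assms, of r]] r by simp
next
  fix k r :: nat assume k: "k \<ge> 9" and r: "r \<in> {1..2 * \<delta> + 1}"
  \<comment> \<open>The independent set has \<open>2 * k + 1\<close> vertices to match the
    non-neighbour count. Its extra vertex accounts for one unit of \<open>r\<close>, so the even
    part carries only \<open>r - 1\<close>, which is why \<open>r\<close> runs from 1 to
    \<open>2 * \<delta> + 1\<close>.\<close>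
  have "ex_clique_saturated (2 * \<delta>) (2 * k + 1) (3 * \<delta> * k + (r - 1))"
    using ex_clique_saturated_even[OF k assms, of "r - 1"] r by auto
  then have join: "ex_clique_saturated (2 * \<delta> + 1) (2 * k + 1)
      (3 * \<delta> * k + (r - 1) + (2 * k + 1))"
    by (rule ex_clique_saturated_add) (rule ex_clique_saturated_independent, simp)
  have n: "3 * \<delta> * k + (r - 1) + (2 * k + 1) = (3 * \<delta> + 2) * k + r"
    using r by (simp add: algebra_simps)
  have d: "(3 * \<delta> + 2) * k + r - (2 * k + 1) = 3 * \<delta> * k + (r - 1)"
    using r by (simp add: algebra_simps)
  have s: "2 * \<delta> + 1 + 1 = 2 * \<delta> + 2" by simp
  show "\<exists>G :: nat ugraph. simple_graph G
        \<and> saturated (complete_graph (2 * \<delta> + 2)) G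
        \<and> card (verts G) = (3 * \<delta> + 2) * k + r
        \<and> regular (3 * \<delta> * k + (r - 1)) G"
    using ex_saturated_regular_graph[OF join[unfolded n]] unfolding d s .
qed

end
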